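(* Let $\mathcal K\subset\mathbb Z^2$ be a two-dimensional convex symmetric neighbourhood, let $\theta$ be a positive integer, and consider the threshold rule $\mathcal U(\mathcal K,\theta)$. Then every isolated stable direction of $\mathcal U(\mathcal K,\theta)$ is voracious.
   Context: An update rule is a finite non-empty subset of $\mathbb Z^2\setminus\{0\}$; an update family $\mathcal U$ is a finite non-empty set of update rules. Given $A=A_0\subseteq\mathbb Z^2$, let $A_{t+1}=A_t\cup\{x\in\mathbb Z^2:\exists U\in\mathcal U,\forall u\in U,\ x+u\in A_t\}$ and $[A]=\bigcup_{t\ge0}A_t$. A neighbourhood is a finite set $\mathcal K\subset\mathbb Z^2$ containing $0$. It is convex symmetric if it is the intersection with $\mathbb Z^2$ of a bounded convex subset of $\mathbb R^2$ that is symmetric (invariant under $x\mapsto-x$). It is two-dimensional if $\mathcal K\not\subset u\mathbb R$ for every $u\in\mathbb R^2$. The threshold rule with neighbourhood $\mathcal K$ and threshold $\theta$ is the update family $\mathcal U(\mathcal K,\theta)=\{U\subseteq\mathcal K\setminus\{0\}:|U|=\theta\}$ (assumed non-empty, i.e. $\theta\le|\mathcal K|-1$, as required of an update family). A direction is a unit vector $u\in S^1\subset\mathbb R^2$. Let $\mathbb H_u=\{x\in\mathbb Z^2:\langle u,x\rangle<0\}$ and $l_u=\{x\in\mathbb Z^2:\langle u,x\rangle=0\}$. A direction $u$ is stable if $[\mathbb H_u]=\mathbb H_u$; it is isolated stable if it is an isolated point of the set of stable directions. For an isolated stable direction $u$, $\alpha(u)=\min\{|Z|:Z\subset\mathbb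 Z^2,\ |[\mathbb H_u\cup Z]\setminus\mathbb H_u|=\infty\}$. A set $Z$ realising this minimum is a helping set for $u$; it is voracious if $[\mathbb H_u\cup Z]\supseteq l_u$. An isolated stable direction is voracious if every helping set for it is voracious. *)

theory Defs
  imports "HOL-Analysis.Analysis"
begin

type_synonym site = "int \<times> int"
type_synonym plane = "real \<times> real"

text \<open>The norm and inner product on \<^typ>\<open>real \<times> real\<close> are the Euclidean ones.\<close>

definition to_plane :: "site \<Rightarrow> plane" where
  "to_plane x = (real_of_int (fst x), real_of_int (snd x))"

definition update_rule :: "site set \<Rightarrow> bool" where
  "update_rule R \<longleftrightarrow> finite R \<and> R \<noteq> {} \<and> 0 \<notin> R"

definition update_family :: "site set set \<Rightarrow> bool" where
  "update_family \<U> \<longleftrightarrow> finite \<U> \<and> \<U> \<noteq> {} \<and> (\<forall>R\<in>\<U>. update_rule R)"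

definition bp_step :: "site set set \<Rightarrow> site set \<Rightarrow> site set" where
  "bp_step \<U> A = A \<union> {x. \<exists>R\<in>\<U>. \<forall>r\<in>R. x + r \<in> A}"

definition bp_closure :: "site set set \<Rightarrow> site set \<Rightarrow> site set" where
  "bp_closure \<U> A = (\<Union>t. (bp_step \<U> ^^ t) A)"

definition neighbourhood :: "site set \<Rightarrow> bool" where
  "neighbourhood K \<longleftrightarrow> finite K \<and> 0 \<in> K"

definition convex_symmetric :: "site set \<Rightarrow> bool" where
  "convex_symmetric K \<longleftrightarrow>
     (\<exists>C :: plane set. bounded C \<and> convex C \<and> uminus ` C = C \<and> K = {x. to_plane x \<in> C})"

definition two_dimensional :: "site set \<Rightarrow> bool" where
  "two_dimensional K \<longleftrightarrow> (\<forall>u :: plane. \<not> to_plane ` K \<subseteq> range (\<lambda>t. t *\<^sub>R u))"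

definition threshold_family :: "site set \<Rightarrow> nat \<Rightarrow> site set set" where
  "threshold_family K \<theta> = {R. R \<subseteq> K - {0} \<and> card R = \<theta>}"

lemma update_family_threshold_family_iff:
  assumes "neighbourhood K" and "\<theta> > 0"
  shows "update_family (threshold_family K \<theta>) \<longleftrightarrow> \<theta> \<le> card K - 1"
proof -
  have fin: "finite (K - {0})" and card_K: "card (K - {0}) = card K - 1"
    using assms(1) by (auto simp: neighbourhood_def)
  have "update_family (threshold_family K \<theta>) \<longleftrightarrow> threshold_family K \<theta> \<noteq> {}"
    using assms(2) fin finite_subset[OF _ fin]
    by (auto simp: update_family_def update_rule_def threshold_family_def)
  also have "\<dots> \<longleftrightarrow> \<theta> \<le> card (K - {0})"
    using fin card_mono[OF fin] obtain_subset_with_card_n[of \<theta> "K - {0}"]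
    by (auto simp: threshold_family_def)
  finally show ?thesis by (simp add: card_K)
qed

definition half_plane :: "plane \<Rightarrow> site set" where
  "half_plane u = {x. u \<bullet> to_plane x < 0}"

definition boundary_line :: "plane \<Rightarrow> site set" where
  "boundary_line u = {x. u \<bullet> to_plane x = 0}"

definition stable_directions :: "site set set \<Rightarrow> plane set" where
  "stable_directions \<U> = {u. norm u = 1 \<and> bp_closure \<U> (half_plane u) = half_plane u}"

text \<open>Being isolated in the plane is the same as being isolated in the unit circle with its
  subspace topology.\<close>

definition isolated_stable :: "site set set \<Rightarrow> plane \<Rightarrow> bool" where
  "isolated_stable \<U> u \<longleftrightarrow> u isolated_in stable_directions \<U>"

definition ecard :: "'a set \<Rightarrow> enat" where
  "ecard Z = (if finite Z then enat (card Z) else \<infinity>)"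

definition infinite_growth :: "site set set \<Rightarrow> plane \<Rightarrow> site set \<Rightarrow> bool" where
  "infinite_growth \<U> u Z \<longleftrightarrow>
     infinite (bp_closure \<U> (half_plane u \<union> Z) - half_plane u)"

text \<open>The infimum is a minimum: \<^typ>\<open>enat\<close> is well-ordered, and the set of all sites satisfies
  \<^const>\<open>infinite_growth\<close>, so the infimum is over a non-empty set.\<close>

definition helping_number :: "site set set \<Rightarrow> plane \<Rightarrow> enat" where
  "helping_number \<U> u = (INF Z \<in> {Z. infinite_growth \<U> u Z}. ecard Z)"

definition helping_set :: "site set set \<Rightarrow> plane \<Rightarrow> site set \<Rightarrow> bool" where
  "helping_set \<U> u Z \<longleftrightarrow> infinite_growth \<U> u Z \<and> ecard Z = helping_number \<U> u"

definition voracious_set :: "site set set \<Rightarrow> plane \<Rightarrow> site set \<Rightarrow> bool" where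
  "voracious_set \<U> u Z \<longleftrightarrow> boundary_line u \<subseteq> bp_closure \<U> (half_plane u \<union> Z)"

definition voracious :: "site set set \<Rightarrow> plane \<Rightarrow> bool" where
  "voracious \<U> u \<longleftrightarrow> (\<forall>Z. helping_set \<U> u Z \<longrightarrow> voracious_set \<U> u Z)"

end

theory Submission
  imports Defs
begin

text \<open>Let \<open>d\<close> be \<open>\<theta>\<close> minus the number of sites of \<open>K\<close> in the half-plane. Tilting \<open>u\<close> slightly adds to
  the half-plane one half of the nonzero sites of \<open>K\<close> on the boundary line; as \<open>u\<close> is isolated
  stable, this gives \<open>0 < d \<le> m\<close>, where \<open>K\<close> meets the line in the multiples \<open>-m w, \<dots>, m w\<close> of a
  primitive vector \<open>w\<close>. Hence \<open>d\<close> consecutive sites of the line infect the whole line, and a helping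
  set \<open>Z\<close> has at most \<open>d\<close> sites.

  Suppose the line is not filled. A site above the line loses the sites of \<open>K\<close> at height \<open>-1\<close>
  (there are some, by convexity), so by counting it can only be infected if it has height \<open>1\<close>, all
  of \<open>Z\<close> is above the line, and a translate of the sites of \<open>K\<close> at height \<open>-1\<close> is infected on the line.
  These are consecutive, so there are fewer than \<open>d\<close> of them, which by convexity forces \<open>K\<close> to have
  only heights \<open>-1, 0, 1\<close>; but then no site of the line sees all of \<open>Z\<close> and nothing is
  infected at all. So apart from \<open>Z\<close> the infection stays on the line. Away from \<open>Z\<close>, the first infection
  beyond a point of the line shows that the site just beyond it is infected too, so an infinite infection
  contains \<open>d\<close> consecutive sites.\<close>

section \<open>The threshold closure as a least closed set\<close>

text \<open>For finite \<open>K\<close>, \<open>bp_closure_subset\<close> and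
  \<open>bp_closed_bp_closure\<close> identify the closure as the least such superset, so later
  arguments compare closed sets and never follow the infection in time.\<close>

definition bp_closed :: "site set \<Rightarrow> nat \<Rightarrow> site set \<Rightarrow> bool" where
  "bp_closed K \<theta> A \<longleftrightarrow> (\<forall>x. \<theta> \<le> card {k \<in> K - {0}. x + k \<in> A} \<longrightarrow> x \<in> A)"

lemma bp_closedD: "bp_closed K \<theta> A \<Longrightarrow> \<theta> \<le> card {k \<in> K - {0}. x + k \<in> A} \<Longrightarrow> x \<in> A"
  unfolding bp_closed_def by (drule spec, erule mp)

lemma mem_bp_step_iff:
  assumes "finite K"
  shows "x \<in> bp_step (threshold_family K \<theta>) A \<longleftrightarrow> x \<in> A \<or> \<theta> \<le> card {k \<in> K - {0}. x + k \<in> A}"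
proof -
  have fin: "finite {k \<in> K - {0}. x + k \<in> A}" using assms by simp
  have "(\<exists>R\<in>threshold_family K \<theta>. \<forall>r\<in>R. x + r \<in> A) \<longleftrightarrow> \<theta> \<le> card {k \<in> K - {0}. x + k \<in> A}"
  proof
    assume "\<exists>R\<in>threshold_family K \<theta>. \<forall>r\<in>R. x + r \<in> A"
    then obtain R where "R \<in> threshold_family K \<theta>" "\<forall>r\<in>R. x + r \<in> A" by (rule bexE)
    then have "R \<subseteq> {k \<in> K - {0}. x + k \<in> A}" "card R = \<theta>"
      by (auto simp: threshold_family_def)
    then show "\<theta> \<le> card {k \<in> K - {0}. x + k \<in> A}" using card_mono[OF fin] by blast
  next
    assume "\<theta> \<le> card {k \<in> K - {0}. x + k \<in> A}"
    then obtain R where "R \<subseteq> {k \<in> K - {0}. x + k \<in> A}" "card R = \<theta>"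
      by (rule obtain_subset_with_card_n)
    then show "\<exists>R\<in>threshold_family K \<theta>. \<forall>r\<in>R. x + r \<in> A"
      by (intro bexI[of _ R]) (auto simp: threshold_family_def)
  qed
  then show ?thesis by (simp add: bp_step_def)
qed

lemma bp_step_mono: "A \<subseteq> B \<Longrightarrow> bp_step \<U> A \<subseteq> bp_step \<U> B"
  by (fastforce simp: bp_step_def)

lemma subset_bp_closure: "A \<subseteq> bp_closure \<U> A"
proof
  fix x assume "x \<in> A"
  then have "x \<in> (bp_step \<U> ^^ 0) A" by simp
  then show "x \<in> bp_closure \<U> A" unfolding bp_closure_def by (rule UN_I[OF UNIV_I])
qed

lemma bp_closure_subset:
  assumes "finite K" "bp_closed K \<theta> B" "A \<subseteq> B"
  shows "bp_closure (threshold_family K \<theta>) A \<subseteq> B"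
proof -
  have step: "bp_step (threshold_family K \<theta>) B \<subseteq> B"
    using assms by (auto simp: mem_bp_step_iff bp_closed_def)
  have "(bp_step (threshold_family K \<theta>) ^^ t) A \<subseteq> B" for t
  proof (induction t)
    case (Suc t)
    then show ?case using bp_step_mono[OF Suc] step by force
  qed (simp add: assms)
  then show ?thesis by (auto simp: bp_closure_def)
qed

text \<open>A site has finitely many infected neighbours, so all of them are already infected at one
  common time.\<close>

lemma bp_closed_bp_closure:
  assumes "finite K"
  shows "bp_closed K \<theta> (bp_closure (threshold_family K \<theta>) A)"
  unfolding bp_closed_def
proof (intro allI impI)
  fix x
  let ?f = "\<lambda>t. (bp_step (threshold_family K \<theta>) ^^ t) A"
  let ?N = "{k \<in> K - {0}. x + k \<in> bp_closure (threshold_family K \<theta>) A}"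
  assume N: "\<theta> \<le> card ?N"
  have mono: "?f s \<subseteq> ?f t" if "s \<le> t" for s t
    using _ that by (rule lift_Suc_mono_le) (simp add: bp_step_def)
  have "\<forall>k\<in>?N. \<exists>t. x + k \<in> ?f t" by (auto simp: bp_closure_def)
  from bchoice[OF this] obtain T where T: "\<forall>k\<in>?N. x + k \<in> ?f (T k)" ..
  have fin: "finite ?N" using assms by simp
  \<comment> \<open>Inserting 0 keeps the maximum meaningful when \<open>?N\<close> is
    empty.\<close>
  define t where "t = Max (insert 0 (T ` ?N))"
  have "x + k \<in> ?f t" if "k \<in> ?N" for k
    using bspec[OF T that] mono[of "T k" t] that fin by (auto simp: t_def)
  then have "?N \<subseteq> {k \<in> K - {0}. x + k \<in> ?f t}" by auto
  then have "card ?N \<le> card {k \<in> K - {0}. x + k \<in> ?f t}"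
    using assms by (intro card_mono) auto
  with N have "\<theta> \<le> card {k \<in> K - {0}. x + k \<in> ?f t}" by simp
  then have "x \<in> ?f (Suc t)" by (simp add: mem_bp_step_iff[OF assms])
  then show "x \<in> bp_closure (threshold_family K \<theta>) A" unfolding bp_closure_def by (rule UN_I[OF UNIV_I])
qed

section \<open>Stable and isolated stable directions of threshold rules\<close>

text \<open>From a site outside the half-plane, only offsets in the half-plane itself can lead into
  it; from the origin all of these do.\<close>

lemma half_plane_stable_iff:
  assumes "finite K" "norm u = 1" "\<theta> > 0"
  shows "u \<in> stable_directions (threshold_family K \<theta>) \<longleftrightarrow> card (K \<inter> half_plane u) < \<theta>"
proof -
  have add: "u \<bullet> to_plane (x + y) = u \<bullet> to_plane x + u \<bullet> to_plane y" for x y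
    by (simp add: to_plane_def inner_prod_def algebra_simps)
  have z: "u \<bullet> to_plane 0 = 0" by (simp add: to_plane_def inner_prod_def)
  have "bp_closure (threshold_family K \<theta>) (half_plane u) = half_plane u"
    if c: "card (K \<inter> half_plane u) < \<theta>"
  proof -
    have "bp_closed K \<theta> (half_plane u)"
      unfolding bp_closed_def
    proof (intro allI impI, rule ccontr)
      fix x assume 1: "\<theta> \<le> card {k \<in> K - {0}. x + k \<in> half_plane u}" and 2: "x \<notin> half_plane u"
      have "{k \<in> K - {0}. x + k \<in> half_plane u} \<subseteq> K \<inter> half_plane u"
        using 2 by (auto simp: half_plane_def add)
      then have "card {k \<in> K - {0}. x + k \<in> half_plane u} \<le> card (K \<inter> half_plane u)"
        using assms(1) by (intro card_mono) auto
      then show False using 1 c by simp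
    qed
    then show ?thesis using bp_closure_subset[OF assms(1)] subset_bp_closure by blast
  qed
  moreover have "card (K \<inter> half_plane u) < \<theta>"
    if "bp_closure (threshold_family K \<theta>) (half_plane u) = half_plane u"
  proof (rule ccontr)
    assume "\<not> card (K \<inter> half_plane u) < \<theta>"
    moreover have "{k \<in> K - {0}. 0 + k \<in> half_plane u} = K \<inter> half_plane u"
      using z by (auto simp: half_plane_def)
    ultimately have "0 \<in> half_plane u"
      using bp_closedD[OF bp_closed_bp_closure[OF assms(1)], of \<theta> 0 "half_plane u"] that by simp
    then show False using z by (simp add: half_plane_def)
  qed
  ultimately show ?thesis using assms by (auto simp: stable_directions_def)
qed

text \<open>Directions obtained by rotating \<open>u\<close> slightly are unstable. For a small
  enough turn towards \<open>p\<close>, the tilted half-plane meets \<open>K\<close> only in old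
  half-plane sites and boundary sites on the negative side of \<open>p\<close>.\<close>

lemma isolated_stable_threshold_bound:
  assumes "finite K" "\<theta> > 0" "isolated_stable (threshold_family K \<theta>) u"
  shows "\<theta> \<le> card (K \<inter> half_plane u) +
    card {k \<in> K. u \<bullet> to_plane k = 0 \<and> (- snd u, fst u) \<bullet> to_plane k < 0}"
proof -
  let ?S = "stable_directions (threshold_family K \<theta>)"
  define p where "p = (- snd u, fst u)"
  define v where "v t = cos t *\<^sub>R u + sin t *\<^sub>R p" for t :: real
  from assms(3) obtain T where T: "u \<in> ?S" "open T" "u \<in> T" "T \<inter> ?S = {u}"
    unfolding isolated_stable_def isolated_in_def by auto
  have nu: "norm u = 1" using T by (simp add: stable_directions_def)
  then have uu: "fst u ^ 2 + snd u ^ 2 = 1" by (simp add: norm_prod_def)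
  have uu': "u \<bullet> u = 1" "p \<bullet> p = 1" "u \<bullet> p = 0"
    using uu by (auto simp: p_def inner_prod_def power2_eq_square algebra_simps)
  have nv: "norm (v t) = 1" for t
  proof -
    have "v t \<bullet> v t = cos t ^ 2 + sin t ^ 2"
      by (simp add: v_def inner_add_left inner_add_right uu' inner_commute[of p u] power2_eq_square)
    then show ?thesis by (simp add: norm_eq_sqrt_inner)
  qed
  have lim: "(v \<longlongrightarrow> v 0) (at_right 0)"
    unfolding v_def by (intro tendsto_intros)
  have v0: "v 0 = u" by (simp add: v_def)
  have e1: "eventually (\<lambda>t. v t \<in> T) (at_right 0)"
    using lim T v0 by (metis topological_tendstoD)
  have e2: "eventually (\<lambda>t. 0 < t \<and> t < pi) (at_right (0::real))"
    using eventually_at_right_real[of 0 pi] by simp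
  \<comment> \<open>A positive product with \<open>u\<close> stays positive by continuity; a zero
    one leaves only the term with \<open>sin t > 0\<close>, so the sign of the product with
    \<open>p\<close> decides.\<close>
  have e3: "eventually (\<lambda>t. v t \<bullet> to_plane k < 0 \<longrightarrow>
      u \<bullet> to_plane k < 0 \<or> u \<bullet> to_plane k = 0 \<and> p \<bullet> to_plane k < 0) (at_right 0)" for k
  proof (cases "u \<bullet> to_plane k > 0")
    case True
    have "((\<lambda>t. v t \<bullet> to_plane k) \<longlongrightarrow> u \<bullet> to_plane k) (at_right 0)"
      using lim unfolding v0 by (intro tendsto_intros)
    from order_tendstoD(1)[OF this True] show ?thesis by eventually_elim auto
  next
    case False
    from e2 show ?thesis
    proof eventually_elim
      case (elim t)
      show ?case
      proof (intro impI)
        assume a: "v t \<bullet> to_plane k < 0"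
        have "sin t > 0" using elim by (simp add: sin_gt_zero)
        then show "u \<bullet> to_plane k < 0 \<or> u \<bullet> to_plane k = 0 \<and> p \<bullet> to_plane k < 0"
          using a False by (auto simp: v_def inner_add_left mult_less_0_iff)
      qed
    qed
  qed
  define G where "G t k \<longleftrightarrow> (v t \<bullet> to_plane k < 0 \<longrightarrow>
      u \<bullet> to_plane k < 0 \<or> u \<bullet> to_plane k = 0 \<and> p \<bullet> to_plane k < 0)" for t k
  have "eventually (\<lambda>t. \<forall>k\<in>K. G t k) (at_right 0)"
    using e3 assms(1) by (simp add: eventually_ball_finite_distrib G_def)
  with e1 e2 have "eventually (\<lambda>t. v t \<in> T \<and> (0 < t \<and> t < pi) \<and> (\<forall>k\<in>K. G t k)) (at_right 0)"
    by eventually_elim blast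
  then obtain t where t: "v t \<in> T" "0 < t" "t < pi" and G: "\<forall>k\<in>K. G t k"
    using eventually_happens'[OF trivial_limit_at_right_real] by blast
  have "v t \<noteq> u"
  proof
    assume "v t = u"
    then have "v t \<bullet> p = 0" by (simp add: uu')
    then show False using t by (simp add: v_def inner_add_left uu' sin_gt_zero less_imp_neq[symmetric])
  qed
  then have "v t \<notin> ?S" using t T by blast
  then have "\<theta> \<le> card (K \<inter> half_plane (v t))"
    using half_plane_stable_iff[OF assms(1) nv assms(2)] by simp
  also have "\<dots> \<le> card ((K \<inter> half_plane u) \<union> {k \<in> K. u \<bullet> to_plane k = 0 \<and> p \<bullet> to_plane k < 0})"
    using G assms(1) by (intro card_mono) (auto simp: half_plane_def G_def)
  also have "\<dots> \<le> card (K \<inter> half_plane u) + card {k \<in> K. u \<bullet> to_plane k = 0 \<and> p \<bullet> to_plane k < 0}"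
    by (rule card_Un_le)
  finally show ?thesis by (simp add: p_def)
qed

section \<open>Lattice coordinates along and across a primitive vector\<close>

definition zscale :: "int \<Rightarrow> site \<Rightarrow> site" where
  "zscale n w = (n * fst w, n * snd w)"

text \<open>This is the determinant of \<open>w\<close> and \<open>x\<close>. For primitive
  \<open>w\<close>, its level sets are the successive lattice lines parallel to
  \<open>w\<close>.\<close>

definition height :: "site \<Rightarrow> site \<Rightarrow> int" where
  "height w x = fst w * snd x - snd w * fst x"

lemma zscale_add: "zscale (a + b) w = zscale a w + zscale b w"
  by (simp add: zscale_def algebra_simps)

lemma zscale_0 [simp]: "zscale 0 w = 0"
  by (simp add: zscale_def zero_prod_def)

lemma zscale_minus: "zscale (- a) w = - zscale a w"
  by (simp add: zscale_def)

lemma zscale_eq_iff [simp]: "w \<noteq> 0 \<Longrightarrow> zscale a w = zscale b w \<longleftrightarrow> a = b"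
  by (cases w) (auto simp: zscale_def zero_prod_def)

lemma height_add [simp]: "height w (x + y) = height w x + height w y"
  by (simp add: height_def algebra_simps)

lemma height_minus [simp]: "height w (- x) = - height w x"
  by (simp add: height_def)

lemma height_diff [simp]: "height w (x - y) = height w x - height w y"
  by (simp add: height_def algebra_simps)

lemma height_0 [simp]: "height w 0 = 0"
  by (simp add: height_def)

lemma height_zscale [simp]: "height w (zscale n w) = 0"
  by (simp add: height_def zscale_def)

lemma height_zscale_right: "height w (zscale n x) = n * height w x"
  by (simp add: height_def zscale_def algebra_simps)

lemma height_eq_0E:
  assumes "coprime (fst w) (snd w)" "height w x = 0"
  obtains n where "x = zscale n w"
proof -
  obtain a b where ab: "a * fst w + b * snd w = 1"
    using assms(1) bezout_int[of "fst w" "snd w"] by (auto simp: coprime_iff_gcd_eq_1)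
  have h: "fst w * snd x = snd w * fst x" using assms(2) by (simp add: height_def)
  \<comment> \<open>The Bezout functional takes the value 1 at \<open>w\<close>, so it reads off the
    multiple.\<close>
  define n where "n = a * fst x + b * snd x"
  have 1: "n * fst w = fst x" and 2: "n * snd w = snd x"
    using ab h unfolding n_def by algebra+
  show thesis using 1 2 by (intro that[of n]) (simp add: zscale_def)
qed

lemma exists_height:
  assumes "coprime (fst w) (snd w)"
  obtains q where "height w q = n"
proof -
  obtain a b where ab: "a * fst w + b * snd w = 1"
    using assms bezout_int[of "fst w" "snd w"] by (auto simp: coprime_iff_gcd_eq_1)
  have "height w (zscale n (- b, a)) = n * (a * fst w + b * snd w)"
    by (simp add: height_def zscale_def algebra_simps)
  then show thesis using that ab by simp
qed

lemma to_plane_add: "to_plane (x + y) = to_plane x + to_plane y"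
  by (simp add: to_plane_def)

lemma to_plane_zscale: "to_plane (zscale n w) = real_of_int n *\<^sub>R to_plane w"
  by (simp add: to_plane_def zscale_def)

section \<open>Rows of lattice sites in a convex set\<close>

lemma convex_segment_zscale:
  assumes "convex C" "to_plane (p + zscale a w) \<in> C" "to_plane (p + zscale b w) \<in> C"
    and "a \<le> i" "i \<le> b"
  shows "to_plane (p + zscale i w) \<in> C"
proof (cases "a = b")
  case True
  then show ?thesis using assms by simp
next
  case False
  define t where "t = (real_of_int i - a) / (b - a)"
  have ba: "real_of_int b - a > 0" using False assms by simp
  have t: "0 \<le> t" "t \<le> 1" using assms ba by (auto simp: t_def field_simps)
  have "t * (real_of_int b - a) = real_of_int i - a" using ba by (simp add: t_def)
  then have e: "(1 - t) * a + t * b = real_of_int i" by (simp add: algebra_simps)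
  have "(1 - t) *\<^sub>R to_plane (p + zscale a w) + t *\<^sub>R to_plane (p + zscale b w)
      = to_plane p + ((1 - t) * a + t * b) *\<^sub>R to_plane w"
    by (simp add: to_plane_add to_plane_zscale algebra_simps)
  also have "\<dots> = to_plane (p + zscale i w)"
    by (simp add: e to_plane_add to_plane_zscale)
  finally show ?thesis
    using convexD[OF assms(1-3), of "1 - t" t] t by simp
qed

text \<open>The cone from a site at height \<open>-h\<close> over the segment from \<open>-m w\<close> to \<open>m w\<close> meets the line at
  height \<open>-1\<close> in a segment of length \<open>2 m (1 - 1 / h) \<ge> m\<close>, in units of \<open>w\<close>.\<close>

lemma convex_row_below:
  assumes "convex C" "coprime (fst w) (snd w)"
    and "to_plane (zscale m w) \<in> C" "to_plane (zscale (- m) w) \<in> C" "m > 0"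
    and "to_plane p \<in> C" "height w p = - h" "h \<ge> 2"
  obtains q where "height w q = - 1" "\<And>i. 0 \<le> i \<Longrightarrow> i < m \<Longrightarrow> to_plane (q + zscale i w) \<in> C"
proof -
  obtain q where q: "height w q = - 1" using exists_height[OF assms(2)] .
  have "height w (p - zscale h q) = 0"
    using q assms(7) by (simp add: height_zscale_right)
  then obtain b where "p - zscale h q = zscale b w" by (rule height_eq_0E[OF assms(2)])
  then have p: "p = zscale h q + zscale b w" by (simp add: algebra_simps)
  \<comment> \<open>The point \<open>p / h\<close> lies at height -1, at position
    \<open>b / h\<close> relative to \<open>q\<close>. The closed interval of length
    \<open>m\<close> centred there contains the \<open>m\<close> consecutive integers starting at
    \<open>n\<close>.\<close>
  define n where "n = \<lceil>real_of_int b / h - m / 2\<rceil>"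
  have h: "real_of_int h \<ge> 2" using assms by simp
  have *: "to_plane (q + zscale j w) \<in> C"
    if j: "\<bar>real_of_int j - b / h\<bar> \<le> m / 2" for j
  proof -
    \<comment> \<open>The line from \<open>p\<close> through the target site meets height 0 at
      \<open>s\<close> times \<open>w\<close>; since \<open>h\<close> is at least 2,
      \<open>s\<close> stays within \<open>m\<close> in absolute value.\<close>
    define s where "s = (real_of_int j - b / h) / (1 - 1 / h)"
    have h1: "1 - 1 / real_of_int h \<ge> 1 / 2" using h by (simp add: field_simps)
    have "\<bar>real_of_int j - b / h\<bar> \<le> m * (1 - 1 / h)"
      using order_trans[OF j] mult_left_mono[OF h1, of "real_of_int m"] assms(5) by simp
    moreover have "1 - 1 / real_of_int h > 0" using h1 by linarith
    ultimately have s: "\<bar>s\<bar> \<le> m" by (simp add: s_def abs_divide pos_divide_le_eq del: less_diff_eq diff_gt_0_iff_gt)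
    have se: "s * (1 - 1 / h) = real_of_int j - b / h" using h by (simp add: s_def)
    define t where "t = (1 + s / m) / 2"
    have m: "real_of_int m > 0" using assms by simp
    have sm: "\<bar>s / m\<bar> \<le> 1" using s m by (simp add: abs_divide)
    then have "- 1 \<le> s / m" by linarith
    moreover from sm have "s / m \<le> 1" by linarith
    ultimately have t: "0 \<le> t" "t \<le> 1" by (auto simp: t_def)
    have te: "(2 * t - 1) * m = s" using m by (simp add: t_def field_simps)
    have "t *\<^sub>R to_plane (zscale m w) + (1 - t) *\<^sub>R to_plane (zscale (- m) w)
        = (t * m + (1 - t) * (- m)) *\<^sub>R to_plane w"
      by (simp only: to_plane_zscale scaleR_left_distrib scaleR_scaleR of_int_minus)
    also have "t * m + (1 - t) * (- m) = (2 * t - 1) * m" by (simp add: algebra_simps)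
    finally have "t *\<^sub>R to_plane (zscale m w) + (1 - t) *\<^sub>R to_plane (zscale (- m) w) = s *\<^sub>R to_plane w"
      by (simp only: te)
    then have sC: "s *\<^sub>R to_plane w \<in> C"
      using convexD[OF assms(1,3,4), of t "1 - t"] t by simp
    have "(1 / h) *\<^sub>R to_plane p + (1 - 1 / h) *\<^sub>R (s *\<^sub>R to_plane w)
        = to_plane q + (b / h + s * (1 - 1 / h)) *\<^sub>R to_plane w"
      using h by (simp add: p to_plane_add to_plane_zscale scaleR_add_right mult.commute scaleR_add_left)
    also have "\<dots> = to_plane (q + zscale j w)"
      by (simp add: se to_plane_add to_plane_zscale)
    finally show ?thesis
      using convexD[OF assms(1,6) sC, of "1 / h" "1 - 1 / h"] h by simp
  qed
  show thesis
  proof (rule that[of "q + zscale n w"])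
    fix i assume i: "0 \<le> i" "i < m"
    have "real_of_int n \<ge> b / h - m / 2" "real_of_int n < b / h - m / 2 + 1"
      unfolding n_def by linarith+
    moreover have "real_of_int i \<le> m - 1" using i by linarith
    moreover have "0 \<le> real_of_int i" using i by simp
    ultimately have "\<bar>real_of_int (n + i) - b / h\<bar> \<le> m / 2" unfolding of_int_add by linarith
    from *[OF this] show "to_plane (q + zscale n w + zscale i w) \<in> C"
      by (simp add: zscale_add add.assoc)
  qed (simp add: q)
qed


text \<open>By convexity the row has no gaps, so its two extreme sites span at least as many
  positions as the row has sites.\<close>

lemma convex_row_consecutive:
  assumes "convex C" "coprime (fst w) (snd w)" "finite {x. to_plane x \<in> C}"
    and "d > 0" "d \<le> card {k. to_plane k \<in> C \<and> height w k = h}"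
  obtains q where "height w q = h" "\<And>i. i < d \<Longrightarrow> to_plane (q + zscale (int i) w) \<in> C"
proof -
  let ?R = "{k. to_plane k \<in> C \<and> height w k = h}"
  have w0: "w \<noteq> 0" using assms(2) by (auto simp: zero_prod_def)
  have "?R \<noteq> {}" using assms(4,5) by (metis card.empty not_le)
  then obtain p where p: "to_plane p \<in> C" "height w p = h" by blast
  have inj: "inj (\<lambda>n. p + zscale n w)" using w0 by (simp add: inj_on_def)
  define T where "T = {n. to_plane (p + zscale n w) \<in> C}"
  have "finite ((\<lambda>n. p + zscale n w) -` {x. to_plane x \<in> C})"
    using assms(3) inj by (rule finite_vimageI)
  then have finT: "finite T" by (simp add: T_def vimage_def)
  have "?R \<subseteq> (\<lambda>n. p + zscale n w) ` T"
  proof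
    fix k assume k: "k \<in> ?R"
    then have "height w (k - p) = 0" using p by simp
    then obtain n where "k - p = zscale n w" by (rule height_eq_0E[OF assms(2)])
    then have "k = p + zscale n w" by (simp add: algebra_simps)
    then show "k \<in> (\<lambda>n. p + zscale n w) ` T" using k by (auto simp: T_def)
  qed
  then have "card ?R \<le> card T" by (rule surj_card_le[OF finT])
  also have "T \<subseteq> {Min T..Max T}" using finT by auto
  then have "card T \<le> nat (Max T - Min T + 1)" using card_mono[of "{Min T..Max T}" T] by simp
  finally have len: "int d \<le> Max T - Min T + 1" using assms(4,5) by linarith
  have "T \<noteq> {}" using p by (auto simp: T_def intro: exI[of _ 0])
  then have "Min T \<in> T" "Max T \<in> T" using finT by simp_all
  then have ends: "to_plane (p + zscale (Min T) w) \<in> C" "to_plane (p + zscale (Max T) w) \<in> C"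
    by (simp_all add: T_def)
  show thesis
  proof (rule that[of "p + zscale (Min T) w"])
    fix i assume "i < d"
    then have "to_plane (p + zscale (Min T + int i) w) \<in> C"
      using len by (intro convex_segment_zscale[OF assms(1) ends]) auto
    then show "to_plane (p + zscale (Min T) w + zscale (int i) w) \<in> C"
      by (simp add: zscale_add add.assoc)
  qed (simp add: p)
qed

text \<open>The vector \<open>k\<close> is a positive multiple of \<open>u\<close> rotated by a right angle, so that the height
  over \<open>k\<close> is a positive multiple of the inner product with \<open>u\<close>.\<close>

lemma primitive_boundary_vector:
  assumes "norm u = 1" "u \<bullet> to_plane k = 0" "(- snd u, fst u) \<bullet> to_plane k < 0"
  obtains w where "coprime (fst w) (snd w)"
    "\<And>x. height w x < 0 \<longleftrightarrow> u \<bullet> to_plane x < 0" "\<And>x. height w x = 0 \<longleftrightarrow> u \<bullet> to_plane x = 0"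
    "\<And>n. (- snd u, fst u) \<bullet> to_plane (zscale n w) < 0 \<longleftrightarrow> n > 0"
proof -
  obtain a b where k: "k = (a, b)" by (cases k)
  define g where "g = gcd a b"
  have "a \<noteq> 0 \<or> b \<noteq> 0" using assms(3) by (auto simp: k to_plane_def inner_prod_def)
  then have g: "g > 0" by (simp add: g_def)
  define w where "w = (a div g, b div g)"
  have cop: "coprime (fst w) (snd w)"
    using \<open>a \<noteq> 0 \<or> b \<noteq> 0\<close> by (auto simp: w_def g_def intro: div_gcd_coprime)
  have kw: "k = zscale g w" by (simp add: k w_def zscale_def g_def)
  define s where "s = snd u * a - fst u * b"
  have s: "s > 0" using assms(3) by (simp add: s_def k to_plane_def inner_prod_def)
  have uu: "fst u * fst u + snd u * snd u = 1"
    using assms(1) by (simp add: norm_prod_def power2_eq_square)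
  have uk: "fst u * a + snd u * b = 0" using assms(2) by (simp add: k to_plane_def inner_prod_def)
  have ab: "real_of_int a = snd u * s" "real_of_int b = - fst u * s"
    unfolding s_def using uu uk by algebra+
  have height: "g * height w x = s * (u \<bullet> to_plane x)" for x
  proof -
    have "g * height w x = height k x"
      by (simp add: kw height_def zscale_def algebra_simps)
    also have "real_of_int \<dots> = s * (u \<bullet> to_plane x)"
      by (simp add: k height_def ab to_plane_def inner_prod_def algebra_simps)
    finally show ?thesis by simp
  qed
  have perp: "(- snd u, fst u) \<bullet> to_plane (zscale n w) = n * ((- snd u, fst u) \<bullet> to_plane w)" for n
    by (simp add: to_plane_zscale)
  then have "(- snd u, fst u) \<bullet> to_plane w < 0"
    using assms(3) g by (simp add: kw mult_less_0_iff)
  with perp have 3: "(- snd u, fst u) \<bullet> to_plane (zscale n w) < 0 \<longleftrightarrow> n > 0" for n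
    by (simp add: mult_less_0_iff)
  have 1: "height w x < 0 \<longleftrightarrow> u \<bullet> to_plane x < 0" for x
  proof -
    have "real_of_int (g * height w x) < 0 \<longleftrightarrow> s * (u \<bullet> to_plane x) < 0" by (simp only: height)
    then show ?thesis using g s by (simp add: mult_less_0_iff)
  qed
  have 2: "height w x = 0 \<longleftrightarrow> u \<bullet> to_plane x = 0" for x
  proof -
    have "real_of_int (g * height w x) = 0 \<longleftrightarrow> s * (u \<bullet> to_plane x) = 0" by (simp only: height)
    then show ?thesis using g s by simp
  qed
  show thesis using that[OF cop 1 2 3] .
qed

section \<open>Infection near the boundary line, by counting\<close>

text \<open>This keeps only the consequences of convexity that the counting needs. The deficit
  \<open>d\<close> is what a site of the line still lacks once the half-plane is infected;
  \<open>below_large\<close> is the dichotomy between a flat \<open>K\<close> with a short row at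
  height -1 and \<open>d\<close> consecutive sites in that row.\<close>

locale threshold_row =
  fixes K :: "site set" and \<theta> d :: nat and w :: site
  assumes fin: "finite K" and zero: "0 \<in> K" and sym: "k \<in> K \<Longrightarrow> - k \<in> K"
    and cop: "coprime (fst w) (snd w)"
    and theta: "\<theta> = card {k \<in> K. height w k < 0} + d" and d: "d > 0"
    and d_row: "zscale (int d) w \<in> K"
    and row: "zscale n w \<in> K \<Longrightarrow> \<bar>i\<bar> \<le> \<bar>n\<bar> \<Longrightarrow> zscale i w \<in> K"
    and below: "\<exists>k\<in>K. height w k = - 1"
    and below_large: "(\<forall>k\<in>K. \<bar>height w k\<bar> \<le> 1) \<and> card {k \<in> K. height w k = - 1} < d \<or>
      (\<exists>q. height w q = - 1 \<and> (\<forall>i<d. q + zscale (int i) w \<in> K))"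
begin

abbreviation Low :: "site set" where
  "Low \<equiv> {x. height w x < 0}"

abbreviation line :: "site set" where
  "line \<equiv> {x. height w x = 0}"

lemma w_nonzero: "w \<noteq> 0"
  using cop by (auto simp: zero_prod_def)

lemma lineE: assumes "height w x = 0" obtains n where "x = zscale n w"
  using height_eq_0E[OF cop assms] .

lemma card_shift_le:
  assumes "finite Z"
  shows "card {k \<in> K. x + k \<in> Z} \<le> card Z"
  by (rule card_inj_on_le[of "\<lambda>k. x + k"]) (auto simp: assms inj_on_def)

lemma card_above_eq_below: "card {k \<in> K. height w k = 1} = card {k \<in> K. height w k = - 1}"
proof (rule bij_betw_same_card[of uminus])
  show "bij_betw uminus {k \<in> K. height w k = 1} {k \<in> K. height w k = - 1}"
    using sym by (intro bij_betw_byWitness[where f' = uminus]) (auto simp: height_def)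
qed

text \<open>The half-plane supplies all but \<open>d\<close> of the neighbours required, and the
  \<open>d\<close> adjacent sites on the side chosen by \<open>e\<close> supply the rest.\<close>

lemma line_infected:
  assumes cl: "bp_closed K \<theta> A" "Low \<subseteq> A" and x: "height w x = 0" and e: "\<bar>e\<bar> = 1"
    and inf: "\<And>i. 1 \<le> i \<Longrightarrow> i \<le> d \<Longrightarrow> x + zscale (e * int i) w \<in> A"
  shows "x \<in> A"
proof (rule bp_closedD[OF cl(1)])
  let ?P = "{k \<in> K. height w k < 0}" and ?Q = "(\<lambda>i. zscale (e * int i) w) ` {1..d}"
  have e0: "e \<noteq> 0" using e by auto
  have "card (?P \<union> ?Q) = card ?P + card ?Q"
    using fin by (intro card_Un_disjoint) auto
  also have "card ?Q = d"
    using e0 w_nonzero by (subst card_image) (auto simp: inj_on_def)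
  finally have c: "card (?P \<union> ?Q) = \<theta>" by (simp add: theta)
  have "?P \<subseteq> {k \<in> K - {0}. x + k \<in> A}" using cl(2) x by auto
  moreover have "?Q \<subseteq> {k \<in> K - {0}. x + k \<in> A}"
  proof
    fix k assume "k \<in> ?Q"
    then obtain i where i: "1 \<le> i" "i \<le> d" "k = zscale (e * int i) w" by auto
    have "k \<in> K" unfolding i(3) using d_row by (rule row) (use i e in \<open>simp add: abs_mult\<close>)
    moreover have "k \<noteq> 0"
      using zscale_eq_iff[OF w_nonzero, of "e * int i" 0] i e0 by simp
    ultimately show "k \<in> {k \<in> K - {0}. x + k \<in> A}" using inf[OF i(1,2)] i(3) by simp
  qed
  ultimately have "?P \<union> ?Q \<subseteq> {k \<in> K - {0}. x + k \<in> A}" by blast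
  then have "card (?P \<union> ?Q) \<le> card {k \<in> K - {0}. x + k \<in> A}"
    using fin by (intro card_mono) auto
  then show "\<theta> \<le> card {k \<in> K - {0}. x + k \<in> A}" by (simp only: c)
qed

lemma consecutive_infects_line:
  assumes cl: "bp_closed K \<theta> A" "Low \<subseteq> A" and n: "\<And>i. i < d \<Longrightarrow> zscale (n + int i) w \<in> A"
  shows "line \<subseteq> A"
proof -
  have right: "zscale (n + int j) w \<in> A" for j
  proof (induction j rule: less_induct)
    case (less j)
    show ?case
    proof (cases "j < d")
      case False
      show ?thesis
      proof (rule line_infected[OF cl, where e = "- 1"])
        fix i assume i: "1 \<le> i" "i \<le> d"
        have "zscale (n + int (j - i)) w \<in> A" using i False by (intro less) auto
        also have "n + int (j - i) = n + int j + (- 1) * int i" using i False by simp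
        finally show "zscale (n + int j) w + zscale (- 1 * int i) w \<in> A"
          by (simp only: zscale_add)
      qed auto
    qed (rule n)
  qed
  \<comment> \<open>The \<open>d\<close> sites to the right of the new one may straddle
    \<open>n\<close>; those beyond it come from \<open>right\<close>.\<close>
  have left: "zscale (n - int j) w \<in> A" for j
  proof (induction j rule: less_induct)
    case (less j)
    show ?case
    proof (rule line_infected[OF cl, where e = 1])
      fix i assume i: "1 \<le> i" "i \<le> d"
      have "zscale (n - int j + int i) w \<in> A"
      proof (cases "i \<le> j")
        case True
        have "zscale (n - int (j - i)) w \<in> A" using i True by (intro less) auto
        also have "n - int (j - i) = n - int j + int i" using True by simp
        finally show ?thesis .
      next
        case False
        have "zscale (n + int (i - j)) w \<in> A" by (rule right)
        also have "n + int (i - j) = n - int j + int i" using False by simp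
        finally show ?thesis .
      qed
      then show "zscale (n - int j) w + zscale (1 * int i) w \<in> A"
        by (simp add: zscale_add)
    qed auto
  qed
  show ?thesis
  proof
    fix x assume "x \<in> line"
    then have "height w x = 0" by simp
    then obtain r where r: "x = zscale r w" by (rule lineE)
    show "x \<in> A"
    proof (cases "n \<le> r")
      case True
      then have "r = n + int (nat (r - n))" by simp
      then show ?thesis using right r by metis
    next
      case False
      then have "r = n - int (nat (n - r))" by simp
      then show ?thesis using left r by metis
    qed
  qed
qed

text \<open>This is the first-infection argument without time. If position \<open>N + 1\<close> were
  healthy, deleting every infected line site beyond \<open>N\<close> would leave a closed set,
  contradicting minimality of \<open>A\<close> and unboundedness.\<close>

lemma far_consecutive:
  assumes cl: "bp_closed K \<theta> A" "Low \<subseteq> A" and Z: "finite Z" "Z \<subseteq> A"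
    and least: "\<And>B. bp_closed K \<theta> B \<Longrightarrow> Low \<union> Z \<subseteq> B \<Longrightarrow> A \<subseteq> B"
    and conf: "A \<subseteq> Low \<union> Z \<union> line"
    and e: "\<bar>e\<bar> = 1" and unb: "\<And>N. \<exists>n>N. zscale (e * n) w \<in> A"
  shows "line \<subseteq> A"
proof -
  have inj: "inj (\<lambda>n. zscale (e * n) w)"
    using e w_nonzero by (auto simp: inj_on_def)
  \<comment> \<open>These are the positions from which an offset in \<open>K\<close> reaches
    \<open>Z\<close>; as 0 is in \<open>K\<close>, positions in \<open>Z\<close> itself are
    included.\<close>
  define V where "V = (\<lambda>n. zscale (e * n) w) -` ((\<lambda>(z, k). z - k) ` (Z \<times> K))"
  have "finite V" unfolding V_def using Z fin inj by (intro finite_vimageI) simp_all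
  then have "bdd_above V" by (rule bdd_above_finite)
  then obtain R where R: "\<forall>n\<in>V. n \<le> R" unfolding bdd_above_def by (rule exE)
  have far: "zscale (e * n) w + k \<notin> Z" if "n > R" "k \<in> K" for n k
  proof
    assume "zscale (e * n) w + k \<in> Z"
    then have "zscale (e * n) w \<in> (\<lambda>(z, k). z - k) ` (Z \<times> K)"
      using that by (intro image_eqI[where x = "(zscale (e * n) w + k, k)"]) auto
    then have "n \<in> V" by (simp add: V_def)
    then show False using R that by auto
  qed
  have next_infected: "zscale (e * (N + 1)) w \<in> A" if N: "N \<ge> R" for N
  proof (rule ccontr)
    assume not: "zscale (e * (N + 1)) w \<notin> A"
    define B where "B = Low \<union> Z \<union> {zscale (e * n) w |n. n \<le> N \<and> zscale (e * n) w \<in> A}"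
    have BA: "B \<subseteq> A" using cl Z by (auto simp: B_def)
    have "bp_closed K \<theta> B"
      unfolding bp_closed_def
    proof (intro allI impI, rule ccontr)
      fix x assume c: "\<theta> \<le> card {k \<in> K - {0}. x + k \<in> B}" and xB: "x \<notin> B"
      have "card {k \<in> K - {0}. x + k \<in> B} \<le> card {k \<in> K - {0}. x + k \<in> A}"
        using BA fin by (intro card_mono) auto
      then have xA: "x \<in> A" using c bp_closedD[OF cl(1), of x] by simp
      then have "height w x = 0" using conf xB by (auto simp: B_def)
      then obtain n' where "x = zscale n' w" by (rule lineE)
      moreover have "n' = e * (e * n')" using e by (auto simp: abs_if split: if_splits)
      ultimately obtain n where x: "x = zscale (e * n) w" by metis
      have n: "n > N"
      proof (rule ccontr)
        assume "\<not> n > N"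
        then have "n \<le> N \<and> zscale (e * n) w \<in> A" using xA x by simp
        then have "x \<in> B" unfolding B_def x by blast
        then show False using xB by simp
      qed
      \<comment> \<open>A site \<open>x\<close> beyond \<open>N\<close> is compared with
        \<open>?y\<close> at position \<open>N + 1\<close>. Adding \<open>?s\<close> turns offsets
        from \<open>x\<close> into offsets from \<open>?y\<close> to the same line sites; these are
        no longer, so \<open>row\<close> keeps them in \<open>K\<close>.\<close>
      let ?s = "zscale (e * (n - (N + 1))) w" and ?y = "zscale (e * (N + 1)) w"
      let ?P = "{k \<in> K. height w k < 0}"
      let ?Q = "{k \<in> K. \<exists>j\<le>N. k = zscale (e * (j - n)) w \<and> zscale (e * j) w \<in> A}"
      have "{k \<in> K - {0}. x + k \<in> B} \<subseteq> ?P \<union> ?Q"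
      proof
        fix k assume "k \<in> {k \<in> K - {0}. x + k \<in> B}"
        then have k: "k \<in> K" "x + k \<in> B" by auto
        have "x + k \<notin> Z" using far[of n k] n N k x by simp
        then consider "x + k \<in> Low" | j where "x + k = zscale (e * j) w" "j \<le> N" "zscale (e * j) w \<in> A"
          using k(2) unfolding B_def by blast
        then show "k \<in> ?P \<union> ?Q"
        proof cases
          case 1
          then show ?thesis using k x by simp
        next
          case 2
          have "zscale (e * n) w + zscale (e * (j - n)) w = zscale (e * j) w"
            by (simp add: zscale_def algebra_simps)
          then have "zscale (e * n) w + k = zscale (e * n) w + zscale (e * (j - n)) w"
            using 2(1) x by simp
          then have "k = zscale (e * (j - n)) w" by (rule add_left_imp_eq)
          then show ?thesis using k 2 by blast
        qed
      qed
      then have "card {k \<in> K - {0}. x + k \<in> B} \<le> card (?P \<union> ?Q)"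
        using fin by (intro card_mono) auto
      also have "\<dots> \<le> card ?P + card ?Q" by (rule card_Un_le)
      also have "card ?Q = card ((\<lambda>k. ?s + k) ` ?Q)"
        by (rule card_image[symmetric]) (simp add: inj_on_def)
      also have "card ?P + \<dots> = card (?P \<union> (\<lambda>k. ?s + k) ` ?Q)"
        using fin by (intro card_Un_disjoint[symmetric]) auto
      also have "\<dots> \<le> card {k \<in> K - {0}. ?y + k \<in> A}"
      proof (rule card_mono)
        have "?P \<subseteq> {k \<in> K - {0}. ?y + k \<in> A}" using cl(2) by auto
        moreover have "(\<lambda>k. ?s + k) ` ?Q \<subseteq> {k \<in> K - {0}. ?y + k \<in> A}"
        proof
          fix k' assume "k' \<in> (\<lambda>k. ?s + k) ` ?Q"
          then obtain j where j: "j \<le> N" "zscale (e * (j - n)) w \<in> K" "zscale (e * j) w \<in> A"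
            and k': "k' = ?s + zscale (e * (j - n)) w" by blast
          have k'e: "k' = zscale (e * (j - (N + 1))) w"
            unfolding k' by (simp add: zscale_def algebra_simps)
          have "k' \<in> K"
            unfolding k'e using j(2) by (rule row) (use j n e in \<open>simp add: abs_mult\<close>)
          moreover have "k' \<noteq> 0"
            using zscale_eq_iff[OF w_nonzero, of "e * (j - (N + 1))" 0] j e k'e by auto
          moreover have "?y + k' = zscale (e * j) w"
            unfolding k'e by (simp add: zscale_def algebra_simps)
          ultimately show "k' \<in> {k \<in> K - {0}. ?y + k \<in> A}" using j by simp
        qed
        ultimately show "?P \<union> (\<lambda>k. ?s + k) ` ?Q \<subseteq> {k \<in> K - {0}. ?y + k \<in> A}" by blast
      qed (use fin in simp)
      finally show False using c bp_closedD[OF cl(1), of ?y] not by simp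
    qed
    then have AB: "A \<subseteq> B" by (rule least) (auto simp: B_def)
    obtain n where n: "n > N" "zscale (e * n) w \<in> A" using unb by blast
    have "zscale (e * n) w \<notin> Z" using far[of n 0] n N zero by simp
    then obtain j where "zscale (e * n) w = zscale (e * j) w" "j \<le> N"
      using n AB by (auto simp: B_def)
    then show False using n inj by (auto dest: injD)
  qed
  \<comment> \<open>For \<open>e = -1\<close> the run found at distances \<open>R + 1\<close> to
    \<open>R + d\<close> is read from its far end, so that positions increase.\<close>
  define n where "n = (if e = 1 then R + 1 else - (R + int d))"
  show ?thesis
  proof (rule consecutive_infects_line[OF cl])
    fix i assume "i < d"
    then have "zscale (e * ((if e = 1 then R + int i else R + int (d - i - 1)) + 1)) w \<in> A"
      by (intro next_infected) auto
    also have "e * ((if e = 1 then R + int i else R + int (d - i - 1)) + 1) = n + int i"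
      using \<open>i < d\<close> e by (auto simp: n_def abs_if of_nat_diff split: if_splits)
    finally show "zscale (n + int i) w \<in> A" .
  qed
qed

text \<open>From above the line, an offset of height -1 no longer reaches the half-plane, while
  \<open>Z\<close> can at most make up the deficit \<open>d\<close>.\<close>

lemma above_uninfected:
  assumes Z: "finite Z" "card Z \<le> d" "Z \<inter> line = {}" and x: "height w x > 0" "x \<notin> Z"
  shows "card {k \<in> K - {0}. x + k \<in> Low \<union> Z} < \<theta>"
proof -
  obtain b where b: "b \<in> K" "height w b = - 1" using below by blast
  let ?P = "{k \<in> K. height w k < 0}"
  have "{k \<in> K - {0}. x + k \<in> Low \<union> Z} \<subseteq> (?P - {b}) \<union> {k \<in> K. x + k \<in> Z}"
    using x b by auto
  then have "card {k \<in> K - {0}. x + k \<in> Low \<union> Z} \<le> card ((?P - {b}) \<union> {k \<in> K. x + k \<in> Z})"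
    using fin by (intro card_mono) auto
  also have "\<dots> \<le> card (?P - {b}) + card {k \<in> K. x + k \<in> Z}" by (rule card_Un_le)
  also have "\<dots> < card ?P + d"
  proof (rule add_less_le_mono)
    show "card (?P - {b}) < card ?P" using b fin by (intro card_Diff1_less) auto
    show "card {k \<in> K. x + k \<in> Z} \<le> d" using card_shift_le[OF Z(1), of x] Z(2) by simp
  qed
  finally show ?thesis by (simp add: theta)
qed

lemma infinite_growth_fills_line:
  assumes Z: "finite Z" "card Z \<le> d"
    and A: "A = bp_closure (threshold_family K \<theta>) (Low \<union> Z)" and inf: "infinite (A - Low)"
  shows "line \<subseteq> A"
proof (rule ccontr)
  assume not: "\<not> line \<subseteq> A"
  have cl: "bp_closed K \<theta> A" unfolding A by (rule bp_closed_bp_closure[OF fin])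
  have sub: "Low \<union> Z \<subseteq> A" unfolding A by (rule subset_bp_closure)
  have least: "A \<subseteq> B" if "bp_closed K \<theta> B" "Low \<union> Z \<subseteq> B" for B
    unfolding A by (rule bp_closure_subset[OF fin that])
  \<comment> \<open>Closedness of \<open>B\<close> will confine the infection outside
    \<open>Z\<close> to the half-plane and the line.\<close>
  define B where "B = Low \<union> Z \<union> (A \<inter> line)"
  have clB: "bp_closed K \<theta> B"
    unfolding bp_closed_def
  proof (intro allI impI, rule ccontr)
    fix x assume c: "\<theta> \<le> card {k \<in> K - {0}. x + k \<in> B}" and xB: "x \<notin> B"
    have "card {k \<in> K - {0}. x + k \<in> B} \<le> card {k \<in> K - {0}. x + k \<in> A}"
      using sub fin by (intro card_mono) (auto simp: B_def)
    then have "x \<in> A" using c bp_closedD[OF cl, of x] by simp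
    then have hx: "height w x > 0" using xB by (auto simp: B_def)
    define Zp where "Zp = {z \<in> Z. height w z > 0}"
    have Zp: "finite Zp" "card Zp \<le> card Z" using Z by (auto simp: Zp_def intro: card_mono)
    let ?P = "{k \<in> K. height w k < 0}"
    \<comment> \<open>These are the offsets from \<open>x\<close> into the half-plane or to infected
      sites of the line.\<close>
    define S where "S = {k \<in> K. height w k < - height w x \<or> height w k = - height w x \<and> x + k \<in> A}"
    have "{k \<in> K - {0}. x + k \<in> B} \<subseteq> S \<union> {k \<in> K. x + k \<in> Zp}"
      using sub by (auto simp: S_def B_def Zp_def)
    then have "card {k \<in> K - {0}. x + k \<in> B} \<le> card (S \<union> {k \<in> K. x + k \<in> Zp})"
      using fin by (intro card_mono) (auto simp: S_def)
    also have "\<dots> \<le> card S + card {k \<in> K. x + k \<in> Zp}" by (rule card_Un_le)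
    finally have ge: "card ?P + d \<le> card S + card Zp"
      using c card_shift_le[OF Zp(1), of x] by (simp add: theta)
    have SP: "S \<subseteq> ?P" using hx by (auto simp: S_def)
    have finP: "finite ?P" using fin by simp
    have "card S \<le> card ?P" using SP finP by (rule card_mono[rotated])
    \<comment> \<open>Both upper bounds must be attained: every downward offset is used and all of
      \<open>Z\<close> lies above the line.\<close>
    then have "card S = card ?P" "card Zp = card Z" using ge Zp Z by auto
    then have S: "S = ?P" and ZpZ: "Zp = Z"
      using card_subset_eq[OF finP SP] card_subset_eq[OF Z(1), of Zp] by (auto simp: Zp_def)
    obtain b where "b \<in> K" "height w b = - 1" using below by blast
    then have "b \<in> S" using S by simp
    then have h1: "height w x = 1" using hx \<open>height w b = - 1\<close> by (auto simp: S_def)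
    have seen: "x + k \<in> A" if "k \<in> K" "height w k = - 1" for k
    proof -
      have "k \<in> S" using S that by simp
      then show ?thesis using that h1 by (simp add: S_def)
    qed
    from below_large show False
    proof
      assume "\<exists>q. height w q = - 1 \<and> (\<forall>i<d. q + zscale (int i) w \<in> K)"
      then obtain q where q: "height w q = - 1" "\<forall>i<d. q + zscale (int i) w \<in> K" by blast
      have "height w (x + q) = 0" using q h1 by simp
      then obtain n where n: "x + q = zscale n w" by (rule lineE)
      have "line \<subseteq> A"
      proof (rule consecutive_infects_line[OF cl])
        fix i assume "i < d"
        then have "x + (q + zscale (int i) w) \<in> A" using q by (intro seen) auto
        then show "zscale (n + int i) w \<in> A" by (simp add: zscale_add n[symmetric] add.assoc)
      qed (use sub in auto)
      then show False using not by blast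
    next
      assume flat: "(\<forall>k\<in>K. \<bar>height w k\<bar> \<le> 1) \<and> card {k \<in> K. height w k = - 1} < d"
      have Zabove: "height w z > 0" if "z \<in> Z" for z using that ZpZ by (auto simp: Zp_def)
      \<comment> \<open>A line site can see \<open>Z\<close> only through offsets of height 1, by
        symmetry fewer than \<open>d\<close>; higher sites fail by \<open>above_uninfected\<close>.
        So nothing new is ever infected.\<close>
      have "bp_closed K \<theta> (Low \<union> Z)"
        unfolding bp_closed_def
      proof (intro allI impI, rule ccontr)
        fix y assume cy: "\<theta> \<le> card {k \<in> K - {0}. y + k \<in> Low \<union> Z}" and y: "y \<notin> Low \<union> Z"
        show False
        proof (cases "height w y = 0")
          case True
          have "{k \<in> K - {0}. y + k \<in> Low \<union> Z} \<subseteq> ?P \<union> {k \<in> K. height w k = 1}"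
          proof
            fix k assume k: "k \<in> {k \<in> K - {0}. y + k \<in> Low \<union> Z}"
            then have "\<bar>height w k\<bar> \<le> 1" using flat by blast
            then show "k \<in> ?P \<union> {k \<in> K. height w k = 1}"
              using k True Zabove[of "y + k"] by auto
          qed
          then have "card {k \<in> K - {0}. y + k \<in> Low \<union> Z} \<le> card (?P \<union> {k \<in> K. height w k = 1})"
            using fin by (intro card_mono) auto
          also have "\<dots> \<le> card ?P + card {k \<in> K. height w k = 1}" by (rule card_Un_le)
          also have "\<dots> < \<theta>" using flat by (simp add: card_above_eq_below theta)
          finally show False using cy by simp
        next
          case False
          then have "card {k \<in> K - {0}. y + k \<in> Low \<union> Z} < \<theta>"
            using y Z Zabove by (intro above_uninfected) force+
          then show False using cy by simp
        qed
      qed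
      then have "A \<subseteq> Low \<union> Z" by (rule least) simp
      then have "A - Low \<subseteq> Z" by blast
      then show False using inf Z finite_subset by blast
    qed
  qed
  have conf: "A \<subseteq> Low \<union> Z \<union> line" using least[OF clB] by (auto simp: B_def)
  \<comment> \<open>Outside the finite \<open>Z\<close> the infinite growth lies on the line, so it
    is unbounded to at least one side.\<close>
  have unb: "\<exists>e. \<bar>e\<bar> = 1 \<and> (\<forall>N. \<exists>n>N. zscale (e * n) w \<in> A)"
  proof (rule ccontr)
    assume "\<not> ?thesis"
    then have "\<not> (\<forall>N. \<exists>n>N. zscale (1 * n) w \<in> A)" "\<not> (\<forall>N. \<exists>n>N. zscale (- 1 * n) w \<in> A)"
      by (metis abs_1 abs_minus_cancel)+
    then obtain N M where N: "\<And>n. zscale n w \<in> A \<Longrightarrow> n \<le> N" and M: "\<And>n. zscale (- n) w \<in> A \<Longrightarrow> n \<le> M"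
      by (auto simp: not_less)
    have "A - Low \<subseteq> Z \<union> (\<lambda>n. zscale n w) ` {- M..N}"
    proof
      fix x assume x: "x \<in> A - Low"
      show "x \<in> Z \<union> (\<lambda>n. zscale n w) ` {- M..N}"
      proof (cases "x \<in> Z")
        case False
        then have "height w x = 0" using x conf by auto
        then obtain n where n: "x = zscale n w" by (rule lineE)
        then have "n \<le> N" "- n \<le> M" using N[of n] M[of "- n"] x by auto
        then show ?thesis using n by auto
      qed simp
    qed
    then show False using inf Z finite_subset by blast
  qed
  then obtain e where "\<bar>e\<bar> = 1" "\<And>N. \<exists>n>N. zscale (e * n) w \<in> A" by blast
  then have "line \<subseteq> A"
    using sub Z least conf by (intro far_consecutive[OF cl, of Z e]) auto
  then show False using not by blast
qed

end

section \<open>From convex symmetric neighbourhoods to the counting hypotheses\<close>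

lemma threshold_row_convex:
  assumes K: "neighbourhood K" "two_dimensional K"
    and C: "convex C" "uminus ` C = C" "K = {x. to_plane x \<in> C}"
    and cop: "coprime (fst w) (snd w)"
    and lower: "card {k \<in> K. height w k < 0} < \<theta>"
    and upper: "\<theta> \<le> card {k \<in> K. height w k < 0} + card {n. n > 0 \<and> zscale n w \<in> K}"
  shows "threshold_row K \<theta> (\<theta> - card {k \<in> K. height w k < 0}) w"
proof -
  let ?d = "\<theta> - card {k \<in> K. height w k < 0}"
  have fin: "finite K" and zero: "0 \<in> K" using K by (simp_all add: neighbourhood_def)
  have KC: "x \<in> K \<longleftrightarrow> to_plane x \<in> C" for x using C(3) by simp
  have sym: "- k \<in> K" if "k \<in> K" for k
  proof -
    have "- to_plane k \<in> uminus ` C" using that KC by blast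
    then show ?thesis using C(2) by (simp add: KC to_plane_def)
  qed
  have row: "zscale i w \<in> K" if n: "zscale n w \<in> K" and i: "\<bar>i\<bar> \<le> \<bar>n\<bar>" for n i
  proof -
    have "zscale (- n) w \<in> K" using sym[OF n] by (simp add: zscale_minus)
    then have "zscale (- \<bar>n\<bar>) w \<in> K" "zscale \<bar>n\<bar> w \<in> K" using n by (auto simp: abs_if)
    then have "to_plane (0 + zscale (- \<bar>n\<bar>) w) \<in> C" "to_plane (0 + zscale \<bar>n\<bar> w) \<in> C"
      by (simp_all add: KC)
    then have "to_plane (0 + zscale i w) \<in> C"
      by (rule convex_segment_zscale[OF C(1)]) (use i in linarith)+
    then show ?thesis by (simp add: KC)
  qed
  have d: "?d > 0" using lower by simp
  have d_row: "zscale (int ?d) w \<in> K"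
  proof (rule ccontr)
    assume not: "zscale (int ?d) w \<notin> K"
    \<comment> \<open>By \<open>row\<close>, omitting multiple \<open>d\<close> omits all larger
      ones too, leaving fewer than \<open>d\<close> positive multiples, against
      \<open>upper\<close>.\<close>
    have "{n. n > 0 \<and> zscale n w \<in> K} \<subseteq> {1..int ?d - 1}"
    proof
      fix n assume n: "n \<in> {n. n > 0 \<and> zscale n w \<in> K}"
      have "n < int ?d"
      proof (rule ccontr)
        assume "\<not> n < int ?d"
        then have "\<bar>int ?d\<bar> \<le> \<bar>n\<bar>" by linarith
        then show False using not row n by blast
      qed
      then show "n \<in> {1..int ?d - 1}" using n by simp
    qed
    then have "card {n. n > 0 \<and> zscale n w \<in> K} \<le> card {1..int ?d - 1}"
      by (intro card_mono) auto
    then show False using upper d by simp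
  qed
  then have d_rowC: "to_plane (zscale (int ?d) w) \<in> C" "to_plane (zscale (- int ?d) w) \<in> C"
    using sym[OF d_row] by (simp_all add: KC zscale_minus)
  \<comment> \<open>Symmetry allows the site to be taken below the line; the cone argument then
    applies with \<open>m\<close> equal to the deficit.\<close>
  have deep: "\<exists>q. height w q = - 1 \<and> (\<forall>i<?d. q + zscale (int i) w \<in> K)"
    if k: "k \<in> K" "\<bar>height w k\<bar> \<ge> 2" for k
  proof -
    obtain p where p: "to_plane p \<in> C" "height w p = - \<bar>height w k\<bar>"
      using that[of k] that[of "- k"] k(1) sym[OF k(1)]
      by (cases "height w k \<le> 0") (simp_all add: KC)
    have d': "0 < int ?d" using d by linarith
    obtain q where q: "height w q = - 1"
      and i: "\<And>i. 0 \<le> i \<Longrightarrow> i < int ?d \<Longrightarrow> to_plane (q + zscale i w) \<in> C"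
      by (rule convex_row_below[OF C(1) cop d_rowC d' p k(2)]) blast
    have "q + zscale (int i) w \<in> K" if "i < ?d" for i
      unfolding KC using that by (intro i) linarith+
    then show ?thesis using q by blast
  qed
  have "\<exists>k\<in>K. height w k \<noteq> 0"
  proof (rule ccontr)
    assume no: "\<not> ?thesis"
    have "to_plane ` K \<subseteq> range (\<lambda>t. t *\<^sub>R to_plane w)"
    proof
      fix y assume "y \<in> to_plane ` K"
      then obtain x where x: "x \<in> K" "y = to_plane x" by blast
      then have "height w x = 0" using no by blast
      then obtain n where "x = zscale n w" by (rule height_eq_0E[OF cop])
      then show "y \<in> range (\<lambda>t. t *\<^sub>R to_plane w)" using x
        by (intro image_eqI[where x = "real_of_int n"]) (simp_all add: to_plane_zscale)
    qed
    then show False using K(2) unfolding two_dimensional_def by blast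
  qed
  then obtain k where k: "k \<in> K" "height w k \<noteq> 0" by blast
  have below: "\<exists>k\<in>K. height w k = - 1"
  proof (cases "\<bar>height w k\<bar> \<ge> 2")
    case True
    then obtain q where "height w q = - 1" "\<forall>i<?d. q + zscale (int i) w \<in> K"
      using deep[OF k(1)] by blast
    moreover from this(2) d have "q + zscale (int 0) w \<in> K" by blast
    ultimately show ?thesis by (intro bexI[of _ q]) simp_all
  next
    case False
    then have "height w k = - 1 \<or> height w (- k) = - 1" using k(2) by auto
    then show ?thesis using k(1) sym by blast
  qed
  have large: "(\<forall>k\<in>K. \<bar>height w k\<bar> \<le> 1) \<and> card {k \<in> K. height w k = - 1} < ?d \<or>
      (\<exists>q. height w q = - 1 \<and> (\<forall>i<?d. q + zscale (int i) w \<in> K))"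
  proof (cases "\<forall>k\<in>K. \<bar>height w k\<bar> \<le> 1")
    case False
    then obtain k where "k \<in> K" "\<bar>height w k\<bar> \<ge> 2" by (auto simp: not_le)
    then show ?thesis using deep by blast
  next
    case True
    show ?thesis
    proof (cases "card {k \<in> K. height w k = - 1} < ?d")
      case False
      then have c: "?d \<le> card {k. to_plane k \<in> C \<and> height w k = - 1}" by (simp add: KC)
      have f: "finite {x. to_plane x \<in> C}" using fin C(3) by simp
      obtain q where "height w q = - 1" and q: "\<And>i. i < ?d \<Longrightarrow> to_plane (q + zscale (int i) w) \<in> C"
        by (rule convex_row_consecutive[OF C(1) cop f d c]) blast
      moreover from q have "\<forall>i<?d. q + zscale (int i) w \<in> K" by (simp only: KC) blast
      ultimately show ?thesis by blast
    qed (use True in blast)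
  qed
  show ?thesis
  proof
    show "\<theta> = card {k \<in> K. height w k < 0} + ?d" using lower by simp
  qed (fact fin zero sym cop d d_row row below large)+
qed

section \<open>Voracity of isolated stable directions\<close>

theorem proposition1p2:
  fixes K :: "site set" and \<theta> :: nat and u :: plane
  assumes "neighbourhood K" and "convex_symmetric K" and "two_dimensional K"
    and "\<theta> > 0" and "update_family (threshold_family K \<theta>)"
    and "isolated_stable (threshold_family K \<theta>) u"
  shows "voracious (threshold_family K \<theta>) u"
proof -
  let ?U = "threshold_family K \<theta>" and ?p = "(- snd u, fst u)"
  have fin: "finite K" using assms(1) by (simp add: neighbourhood_def)
  obtain C where C: "convex C" "uminus ` C = C" "K = {x. to_plane x \<in> C}"
    using assms(2) unfolding convex_symmetric_def by blast
  have u: "u \<in> stable_directions ?U"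
    using assms(6) by (simp add: isolated_stable_def isolated_in_def)
  then have nu: "norm u = 1" by (simp add: stable_directions_def)
  have lower: "card (K \<inter> half_plane u) < \<theta>"
    using u half_plane_stable_iff[OF fin nu assms(4)] by simp
  let ?M = "{k \<in> K. u \<bullet> to_plane k = 0 \<and> ?p \<bullet> to_plane k < 0}"
  have upper: "\<theta> \<le> card (K \<inter> half_plane u) + card ?M"
    by (rule isolated_stable_threshold_bound[OF fin assms(4,6)])
  \<comment> \<open>Stability makes the half-plane count too small, so \<open>K\<close> has a
    nonzero site on the boundary line, which makes the direction rational.\<close>
  then have "card ?M \<noteq> 0" using lower by simp
  then have "?M \<noteq> {}" by (metis card.empty)
  then obtain k where k: "u \<bullet> to_plane k = 0" "?p \<bullet> to_plane k < 0" by blast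
  obtain w where w: "coprime (fst w) (snd w)"
    and neg: "\<And>x. height w x < 0 \<longleftrightarrow> u \<bullet> to_plane x < 0"
    and zero: "\<And>x. height w x = 0 \<longleftrightarrow> u \<bullet> to_plane x = 0"
    and pos: "\<And>n. ?p \<bullet> to_plane (zscale n w) < 0 \<longleftrightarrow> n > 0"
    using primitive_boundary_vector[OF nu k] by blast
  have half: "half_plane u = {x. height w x < 0}" by (simp add: half_plane_def neg)
  have line: "boundary_line u = {x. height w x = 0}" by (simp add: boundary_line_def zero)
  have w0: "w \<noteq> 0" using w by (auto simp: zero_prod_def)
  have inj: "inj (\<lambda>n. zscale n w)" using w0 by (simp add: inj_on_def)
  let ?N = "{n. n > 0 \<and> zscale n w \<in> K}"
  have "?M \<subseteq> (\<lambda>n. zscale n w) ` ?N"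
  proof
    fix x assume x: "x \<in> ?M"
    then have "height w x = 0" by (simp add: zero)
    then obtain n where "x = zscale n w" by (rule height_eq_0E[OF w])
    then show "x \<in> (\<lambda>n. zscale n w) ` ?N" using x pos by auto
  qed
  moreover have "finite ?N"
    using finite_vimageI[OF fin inj] by (rule rev_finite_subset) auto
  ultimately have "card ?M \<le> card ?N" by (intro surj_card_le) auto
  moreover have low: "K \<inter> half_plane u = {k \<in> K. height w k < 0}" by (auto simp: half)
  ultimately have "threshold_row K \<theta> (\<theta> - card {k \<in> K. height w k < 0}) w"
    using lower upper by (intro threshold_row_convex[OF assms(1,3) C w]) auto
  then interpret threshold_row K \<theta> "\<theta> - card {k \<in> K. height w k < 0}" w .
  let ?d = "\<theta> - card {k \<in> K. height w k < 0}"
  \<comment> \<open>These \<open>d\<close> consecutive sites fill the line, which bounds the helping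
    number by \<open>d\<close>.\<close>
  define W where "W = (\<lambda>i. zscale (int i) w) ` {..<?d}"
  let ?B = "bp_closure ?U (half_plane u \<union> W)"
  have sub: "half_plane u \<union> W \<subseteq> ?B" by (rule subset_bp_closure)
  have "boundary_line u \<subseteq> ?B"
    unfolding line
  proof (rule consecutive_infects_line[where n = 0])
    show "bp_closed K \<theta> ?B" by (rule bp_closed_bp_closure[OF fin])
    show "{x. height w x < 0} \<subseteq> ?B" using sub by (simp add: half)
    fix i assume "i < ?d"
    then show "zscale (0 + int i) w \<in> ?B" using sub by (auto simp: W_def)
  qed
  moreover have "range (\<lambda>n. zscale n w) \<subseteq> boundary_line u - half_plane u"
    by (auto simp: half line)
  ultimately have "range (\<lambda>n. zscale n w) \<subseteq> ?B - half_plane u" by blast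
  then have "infinite_growth ?U u W"
    unfolding infinite_growth_def by (rule infinite_super) (use inj in \<open>simp add: finite_image_iff infinite_UNIV_int\<close>)
  moreover have "ecard W \<le> enat ?d"
    using card_image_le[of "{..<?d}" "\<lambda>i. zscale (int i) w"] by (simp add: ecard_def W_def)
  ultimately have number: "helping_number ?U u \<le> enat ?d"
    unfolding helping_number_def by (intro INF_lower2[of W]) auto
  show ?thesis
    unfolding voracious_def voracious_set_def
  proof (intro allI impI)
    fix Z assume Z: "helping_set ?U u Z"
    then have "ecard Z \<le> enat ?d" using number by (simp add: helping_set_def)
    then have "finite Z" "card Z \<le> ?d" by (auto simp: ecard_def split: if_splits)
    moreover have "infinite (bp_closure ?U (half_plane u \<union> Z) - half_plane u)"
      using Z by (simp add: helping_set_def infinite_growth_def)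
    ultimately show "boundary_line u \<subseteq> bp_closure ?U (half_plane u \<union> Z)"
      using infinite_growth_fills_line[OF _ _ refl, of Z] unfolding half line by blast
  qed
qed

end
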